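(* The number of hills of a Dyck path $P\in D_n$ is given by $$\|\mathcal{F}_{\sim P}\|-|\mathcal{F}_{\sim P}^*|.$$
   Context: A Dyck path of semilength $n$ is a lattice path from $(0,0)$ to $(2n,0)$ using steps $u=(1,1)$ and $d=(1,-1)$ and never going below the $x$-axis. A hill is a pair of consecutive steps $ud$ starting and ending on the $x$-axis. $D_n$ is the set of Dyck paths of semilength $n$, ordered by $P\le Q$ iff $P$ lies weakly below $Q$; it is a finite distributive lattice with minimum $0=(ud)^n$, hence a Heyting algebra, with pseudocomplement $\sim\! P=\bigvee\{Z\in D_n : P\wedge Z=0\}$. Put $[n-1]=\{1,\ldots,n-1\}$. The join-irreducible elements of $D_n$ (other than the minimum) are the paths $J_{[a,b]}=(ud)^{a-1}u^{b-a+2}d^{b-a+2}(ud)^{n-1-b}$ for nonempty intervals $[a,b]=\{a,\ldots,b\}$ of $[n-1]$; the atoms are the $J_{[i,i]}$ ($J_{[i,i]}$ is the atom of order $i$), and the atoms below $J_{[a,b]}$ are those of orders in $[a,b]$. For $P\in D_n$, $\mathcal{F}_P$ denotes the antichain (with respect to inclusion) of intervals of $[n-1]$ representing $P$: it consists of the intervals $I$ such that $J_I$ occurs in the irredundant decomposition of $P$ as a join of join-irreducibles, i.e. the inclusion-maximal intervals $I$ with $J_I\le P$. If $\mathcal{F}_P=\{I_1,\ldots,I_m\}$, then $|\mathcal{F}_P|=m$ and $\|\mathcal{F}_P\|=|I_1\cup\cdots\cup I_m|$. An interval $I\in\mathcal{F}_P$ is internal if $1\notin I$ and $n-1\notin I$;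 $\mathcal{F}_P^*$ is the set of internal intervals of $\mathcal{F}_P$.
   Formalization: The formula is proved for every Dyck path P other than the minimum (ud)^n; for P = (ud)^n with n ≥ 1 it fails, since P has n hills while the formula gives n−1 (the empty path, n = 0, is also left out). *)

theory Defs
  imports "HOL-Algebra.Lattice"
begin

datatype step = Up | Down

type_synonym path = "step list"

fun rise :: "step \<Rightarrow> int" where
  "rise Up = 1"
| "rise Down = -1"

text \<open>Ordinate of the path at abscissa \<open>k\<close>; for \<open>k\<close> beyond the end of the path this is the final ordinate.\<close>

definition height :: "path \<Rightarrow> nat \<Rightarrow> int" where
  "height P k = (\<Sum>s\<leftarrow>take k P. rise s)"

definition dyck_paths :: "nat \<Rightarrow> path set" where
  "dyck_paths n = {P. length P = 2 * n \<and> height P (2 * n) = 0 \<and> (\<forall>k \<le> 2 * n. 0 \<le> height P k)}"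

text \<open>Comparing ordinates at integer abscissae suffices, since paths are linear in between.\<close>

definition weakly_below :: "path \<Rightarrow> path \<Rightarrow> bool" where
  "weakly_below P Q \<longleftrightarrow> (\<forall>k. height P k \<le> height Q k)"

definition dyck_lattice :: "nat \<Rightarrow> path gorder" where
  "dyck_lattice n = \<lparr>carrier = dyck_paths n, eq = (=), le = weakly_below\<rparr>"

definition num_hills :: "path \<Rightarrow> nat" where
  "num_hills P = card {k. Suc k < length P \<and> P ! k = Up \<and> P ! Suc k = Down \<and>
                          height P k = 0 \<and> height P (k + 2) = 0}"

definition ud_power :: "nat \<Rightarrow> path" where
  "ud_power k = concat (replicate k [Up, Down])"

text \<open>\<open>ud_power n\<close> is the minimum of the lattice of Dyck paths of semilength \<open>n\<close>.\<close>

definition pseudocomplement :: "nat \<Rightarrow> path \<Rightarrow> path" where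
  "pseudocomplement n P =
     \<Squnion>\<^bsub>dyck_lattice n\<^esub> {Z \<in> dyck_paths n. P \<sqinter>\<^bsub>dyck_lattice n\<^esub> Z = ud_power n}"

definition intervals :: "nat \<Rightarrow> nat set set" where
  "intervals n = {{a..b} | a b. 1 \<le> a \<and> a \<le> b \<and> b \<le> n - 1}"

text \<open>The natural-number subtractions are exact for \<open>I \<in> intervals n\<close>.\<close>

definition join_irr :: "nat \<Rightarrow> nat set \<Rightarrow> path" where
  "join_irr n I = (let a = Min I; b = Max I in
     ud_power (a - 1) @ replicate (b - a + 2) Up @ replicate (b - a + 2) Down @ ud_power (n - 1 - b))"

definition rep_intervals :: "nat \<Rightarrow> path \<Rightarrow> nat set set" where
  "rep_intervals n P =
     {I \<in> intervals n. weakly_below (join_irr n I) P \<and>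
        (\<forall>I' \<in> intervals n. weakly_below (join_irr n I') P \<longrightarrow> \<not> I \<subset> I')}"

definition internal_intervals :: "nat \<Rightarrow> nat set set \<Rightarrow> nat set set" where
  "internal_intervals n F = {I \<in> F. 1 \<notin> I \<and> n - 1 \<notin> I}"

end

theory Submission
  imports Defs
begin

text \<open>
  Let \<open>T\<close> be the set of \<open>i \<in> [n - 1]\<close> such that \<open>P\<close> touches the axis at abscissa \<open>2i\<close>, that is, of the
  orders of the atoms not below \<open>P\<close>. Paths disjoint from \<open>P\<close> leave the axis at even abscissae \<open>2i\<close>
  with \<open>i \<in> T\<close> only, and joins are pointwise maxima, so the intervals representing \<open>\<sim>P\<close> are the
  maximal intervals contained in \<open>T\<close>. A hill is a pair of consecutive elements of \<open>T \<union> {0, n}\<close>;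
  a maximal interval of length \<open>m\<close> accounts for \<open>m\<close> hills if it contains \<open>1\<close> or \<open>n - 1\<close> and for
  \<open>m - 1\<close> hills otherwise. No interval contains both since \<open>P\<close> is not the minimum.
\<close>

subsection \<open>Heights of Dyck paths\<close>

lemma height_0 [simp]: "height P 0 = 0"
  by (simp add: height_def)

lemma height_Nil [simp]: "height [] k = 0"
  by (simp add: height_def)

lemma height_Suc: "k < length P \<Longrightarrow> height P (Suc k) = height P k + rise (P ! k)"
  by (simp add: height_def take_Suc_conv_app_nth)

lemma height_append: "height (P @ Q) k = height P k + height Q (k - length P)"
  by (simp add: height_def)

lemma height_beyond: "length P \<le> k \<Longrightarrow> height P k = height P (length P)"
  by (simp add: height_def)

lemma rise_cases: "rise s = 1 \<or> rise s = -1"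
  by (cases s) auto

lemma rise_inj: "rise s = rise t \<Longrightarrow> s = t"
  by (cases s; cases t) auto

lemma height_parity: "k \<le> length P \<Longrightarrow> even (height P k) \<longleftrightarrow> even k"
proof (induction k)
  case (Suc k)
  then show ?case using rise_cases[of "P ! k"] by (auto simp: height_Suc)
qed simp

lemma height_inject:
  assumes "length P = length Q" and "\<And>k. k \<le> length P \<Longrightarrow> height P k = height Q k"
  shows "P = Q"
proof (rule nth_equalityI)
  fix k assume k: "k < length P"
  then have "height P (Suc k) = height Q (Suc k)" "height P k = height Q k"
    using assms(2) by auto
  then have "rise (P ! k) = rise (Q ! k)"
    using k assms(1) by (simp add: height_Suc)
  then show "P ! k = Q ! k" by (rule rise_inj)
qed (fact assms(1))

lemma dyck_length: "P \<in> dyck_paths n \<Longrightarrow> length P = 2 * n"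
  by (simp add: dyck_paths_def)

lemma dyck_height_nonneg: "P \<in> dyck_paths n \<Longrightarrow> 0 \<le> height P k"
  using height_beyond[of P k] by (cases "k \<le> 2 * n") (auto simp: dyck_paths_def)

lemma dyck_height_end: "P \<in> dyck_paths n \<Longrightarrow> 2 * n \<le> k \<Longrightarrow> height P k = 0"
  using height_beyond[of P k] by (auto simp: dyck_paths_def)

lemma dyck_step: "P \<in> dyck_paths n \<Longrightarrow> k < 2 * n \<Longrightarrow> \<bar>height P (Suc k) - height P k\<bar> = 1"
  using rise_cases[of "P ! k"] by (auto simp: height_Suc dyck_length)

text \<open>From abscissa \<open>2 * n\<close> on the height is constantly 0, hence even whatever
  the parity of \<open>k\<close>; the second disjunct accounts for this.\<close>

lemma dyck_parity: "P \<in> dyck_paths n \<Longrightarrow> even (height P k) \<longleftrightarrow> even k \<or> 2 * n \<le> k"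
  using height_parity[of k P] dyck_height_end[of P n k]
  by (cases "k < 2 * n") (auto simp: dyck_length)

lemma dyck_eqI:
  assumes "P \<in> dyck_paths n" "Q \<in> dyck_paths n"
    and "\<And>k. k \<le> 2 * n \<Longrightarrow> height P k = height Q k"
  shows "P = Q"
  using assms by (intro height_inject) (auto simp: dyck_length)

lemma weakly_below_dyckI:
  assumes "P \<in> dyck_paths n" "Q \<in> dyck_paths n"
    and "\<And>k. k \<le> 2 * n \<Longrightarrow> height P k \<le> height Q k"
  shows "weakly_below P Q"
  unfolding weakly_below_def
proof
  fix k show "height P k \<le> height Q k"
    using assms dyck_height_end[of P n k] dyck_height_end[of Q n k]
    by (cases "k \<le> 2 * n") auto
qed

lemma finite_dyck_paths: "finite (dyck_paths n)"
proof (rule finite_subset)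
  have "UNIV = {Up, Down}" using step.exhaust by auto
  then show "finite {P :: path. set P \<subseteq> UNIV \<and> length P = 2 * n}"
    by (intro finite_lists_length_eq) (metis finite.emptyI finite.insertI)
qed (auto simp: dyck_paths_def)

section \<open>Paths with prescribed heights, pointwise minima and maxima\<close>

lemma dyck_path_of_heights:
  fixes f :: "nat \<Rightarrow> int"
  assumes "f 0 = 0" "f (2 * n) = 0" and nonneg: "\<And>k. k \<le> 2 * n \<Longrightarrow> 0 \<le> f k"
    and step: "\<And>k. k < 2 * n \<Longrightarrow> \<bar>f (Suc k) - f k\<bar> = 1"
  obtains Q where "Q \<in> dyck_paths n" "\<And>k. k \<le> 2 * n \<Longrightarrow> height Q k = f k"
proof -
  \<comment> \<open>Each step is read off from the sign of the next increment of
    \<open>f\<close>.\<close>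
  define Q where "Q = map (\<lambda>k. if f (Suc k) > f k then Up else Down) [0..<2 * n]"
  have h: "height Q k = f k" if "k \<le> 2 * n" for k
    using that
  proof (induction k)
    case 0
    then show ?case by (simp add: assms)
  next
    case (Suc k)
    then have "height Q (Suc k) = f k + rise (Q ! k)"
      by (simp add: height_Suc Q_def)
    also have "\<dots> = f (Suc k)"
      using Suc.prems step[of k] by (auto simp: Q_def)
    finally show ?case .
  qed
  have "Q \<in> dyck_paths n"
    using h assms by (auto simp: dyck_paths_def Q_def)
  then show ?thesis using h that by blast
qed

text \<open>Parity excludes a difference of 0 between consecutive values.\<close>

lemma dyck_path_of_selection:
  assumes A: "A \<subseteq> dyck_paths n"
    and sel: "\<And>k. \<exists>Z \<in> A. f k = height Z k"
    and step: "\<And>k. k < 2 * n \<Longrightarrow> \<bar>f (Suc k) - f k\<bar> \<le> 1"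
  obtains Q where "Q \<in> dyck_paths n" "\<And>k. k \<le> 2 * n \<Longrightarrow> height Q k = f k"
proof (rule dyck_path_of_heights[of f n])
  have parity: "even (f k) \<longleftrightarrow> even k \<or> 2 * n \<le> k" for k
    using sel[of k] A dyck_parity by (metis subsetD)
  show "f 0 = 0" using sel[of 0] by auto
  show "f (2 * n) = 0" using sel[of "2 * n"] A dyck_height_end by force
  show "0 \<le> f k" for k using sel[of k] A dyck_height_nonneg by force
  show "\<bar>f (Suc k) - f k\<bar> = 1" if "k < 2 * n" for k
  proof -
    have "f (Suc k) \<noteq> f k"
      using parity[of k] parity[of "Suc k"] that by (cases "f (Suc k) = f k") presburger+
    then show ?thesis using step[OF that] by linarith
  qed
qed (use that in blast)

text \<open>The minimum of two quantities that each move by 1 moves by at most 1, so the selection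
  argument applies. The path obtained is the binary meet.\<close>

lemma dyck_min:
  assumes "P \<in> dyck_paths n" "Q \<in> dyck_paths n"
  obtains M where "M \<in> dyck_paths n" "\<And>k. height M k = min (height P k) (height Q k)"
proof (rule dyck_path_of_selection[of "{P, Q}" n "\<lambda>k. min (height P k) (height Q k)"])
  show "\<exists>Z\<in>{P, Q}. min (height P k) (height Q k) = height Z k" for k
    by (auto simp: min_def)
  show "\<bar>min (height P (Suc k)) (height Q (Suc k)) - min (height P k) (height Q k)\<bar> \<le> 1"
    if "k < 2 * n" for k
    using dyck_step[OF assms(1) that] dyck_step[OF assms(2) that] by linarith
  fix M assume M: "M \<in> dyck_paths n"
    "\<And>k. k \<le> 2 * n \<Longrightarrow> height M k = min (height P k) (height Q k)"
  have "height M k = min (height P k) (height Q k)" for k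
    using M assms by (cases "k \<le> 2 * n") (auto simp: dyck_height_end)
  with M(1) show ?thesis by (rule that)
qed (use assms in auto)

text \<open>The pointwise maximum of finitely many paths is again a path. That each of its heights
  is attained in \<open>A\<close> makes it the least upper bound, and lets a positive height of a
  join be traced back to a single member.\<close>

lemma dyck_Max:
  assumes "A \<subseteq> dyck_paths n" "A \<noteq> {}"
  obtains M where "M \<in> dyck_paths n" "\<And>Z. Z \<in> A \<Longrightarrow> weakly_below Z M"
    "\<And>k. \<exists>Z \<in> A. height M k = height Z k"
proof -
  define f where "f k = Max ((\<lambda>Z. height Z k) ` A)" for k
  have fin: "finite A" using assms(1) finite_dyck_paths by (rule finite_subset)
  have sel: "\<exists>Z \<in> A. f k = height Z k" for k
    using Max_in[of "(\<lambda>Z. height Z k) ` A"] fin assms(2) unfolding f_def by blast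
  have ge: "height Z k \<le> f k" if "Z \<in> A" for Z k
    using that fin unfolding f_def by (intro Max_ge) auto
  have step: "\<bar>f (Suc k) - f k\<bar> \<le> 1" if "k < 2 * n" for k
  proof -
    obtain Y Z where YZ: "Y \<in> A" "f k = height Y k" "Z \<in> A" "f (Suc k) = height Z (Suc k)"
      using sel by metis
    then have "\<bar>height Y (Suc k) - height Y k\<bar> = 1" "\<bar>height Z (Suc k) - height Z k\<bar> = 1"
      using dyck_step[OF _ that] assms(1) by auto
    \<comment> \<open>\<open>Y\<close> attains the maximum at \<open>k\<close> and drops by at most
      1, so \<open>f\<close> does too; \<open>Z\<close> attains it at \<open>Suc k\<close> after
      gaining at most 1, so \<open>f\<close> gains at most 1.\<close>
    with YZ ge[of Y "Suc k"] ge[of Z k] show ?thesis by linarith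
  qed
  obtain M where M: "M \<in> dyck_paths n" "\<And>k. k \<le> 2 * n \<Longrightarrow> height M k = f k"
    using dyck_path_of_selection[OF assms(1) sel step] by blast
  show ?thesis
  proof (rule that[OF M(1)])
    show "weakly_below Z M" if "Z \<in> A" for Z
      using that assms(1) M ge by (intro weakly_below_dyckI[of _ n]) auto
    show "\<exists>Z \<in> A. height M k = height Z k" for k
    proof (cases "k \<le> 2 * n")
      case True
      then show ?thesis using M(2) sel by auto
    next
      case False
      obtain Z where "Z \<in> A" using assms(2) by blast
      moreover have "Z \<in> dyck_paths n" using calculation assms(1) by blast
      ultimately show ?thesis
        using False M(1) by (intro bexI[of _ Z]) (auto simp: dyck_height_end)
    qed
  qed
qed

section \<open>The minimum of the lattice\<close>

lemma length_ud_power [simp]: "length (ud_power c) = 2 * c"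
  by (induction c) (auto simp: ud_power_def)

lemma height_ud_power: "height (ud_power c) k = (if odd k \<and> k < 2 * c then 1 else 0)"
proof (induction c arbitrary: k)
  case 0
  then show ?case by (simp add: ud_power_def)
next
  case (Suc c)
  have "ud_power (Suc c) = [Up, Down] @ ud_power c" by (simp add: ud_power_def)
  then have "height (ud_power (Suc c)) k = height [Up, Down] k + height (ud_power c) (k - 2)"
    by (simp only: height_append) (simp add: numeral_2_eq_2)
  moreover have "height [Up, Down] k = (if k = 1 then 1 else 0)"
  proof -
    consider "k = 0" | "k = 1" | "k \<ge> 2" by linarith
    then show ?thesis by cases (auto simp: height_def)
  qed
  \<comment> \<open>At \<open>k = 1\<close> the truncated subtraction gives 0, which is
    even.\<close>
  moreover have "odd (k - 2) \<longleftrightarrow> odd k \<and> k \<noteq> 1" by presburger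
  ultimately show ?case by (auto simp: Suc.IH)
qed

lemma ud_power_dyck: "ud_power n \<in> dyck_paths n"
  by (simp add: dyck_paths_def height_ud_power)

text \<open>Between two zeros at distance 2 a nonnegative path can only go up and down. Equality
  with the minimum thus becomes a condition on the even abscissae, one for each atom.\<close>

lemma dyck_eq_ud_power_iff:
  assumes "P \<in> dyck_paths n"
  shows "P = ud_power n \<longleftrightarrow> (\<forall>i \<in> {1..n - 1}. height P (2 * i) = 0)"
proof
  assume zero: "\<forall>i \<in> {1..n - 1}. height P (2 * i) = 0"
  have even_zero: "height P (2 * i) = 0" for i
    using zero dyck_height_end[OF assms, of "2 * i"] by (cases "i = 0 \<or> n \<le> i") auto
  show "P = ud_power n"
  proof (rule dyck_eqI[OF assms ud_power_dyck])
    fix k assume "k \<le> 2 * n"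
    show "height P k = height (ud_power n) k"
    proof (cases "even k")
      case True
      then show ?thesis using even_zero by (auto simp: height_ud_power)
    next
      case False
      then obtain i where i: "k = Suc (2 * i)" by (metis oddE Suc_eq_plus1)
      with \<open>k \<le> 2 * n\<close> have "2 * i < 2 * n" by linarith
      then have "height P k = 1"
        using dyck_step[OF assms] dyck_height_nonneg[OF assms, of k] even_zero[of i] i by fastforce
      then show ?thesis using False \<open>2 * i < 2 * n\<close> i by (simp add: height_ud_power)
    qed
  qed
qed (simp add: height_ud_power)

section \<open>Join-irreducible paths\<close>

lemma height_replicate: "height (replicate m s) k = int (min k m) * rise s"
  by (auto simp: height_def sum_list_replicate min_def)

text \<open>The summands are the contributions of the four blocks. Truncated subtraction makes a
  block contribute 0 before it starts, and each contribution is constant once the block is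
  passed.\<close>

lemma height_mountain:
  "height (ud_power p @ replicate m Up @ replicate m Down @ ud_power c) k =
     (if odd k \<and> k < 2 * p then 1 else 0) + int (min (k - 2 * p) m)
     - int (min (k - 2 * p - m) m) + (if odd k \<and> 2 * p + 2 * m < k \<and> k < 2 * (p + m + c) then 1 else 0)"
proof -
  have "odd (k - 2 * p - m - m) \<longleftrightarrow> odd k \<and> 2 * p + 2 * m < k"
    by (cases "2 * p + 2 * m \<le> k") presburger+
  moreover have "k - 2 * p - m - m < 2 * c \<longleftrightarrow> k < 2 * (p + m + c)" if "2 * p + 2 * m < k"
    using that by auto
  ultimately show ?thesis
    by (auto simp: height_append height_ud_power height_replicate diff_diff_left)
qed

lemma intervalsI: "1 \<le> a \<Longrightarrow> a \<le> b \<Longrightarrow> b \<le> n - 1 \<Longrightarrow> {a..b} \<in> intervals n"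
  unfolding intervals_def by blast

lemma intervals_atLeastAtMost:
  assumes "I \<in> intervals n"
  obtains a b where "I = {a..b}" "1 \<le> a" "a \<le> b" "b \<le> n - 1"
  using assms by (auto simp: intervals_def)

text \<open>The mountain stands on the axis from abscissa \<open>2 * (a - 1)\<close> to
  \<open>2 * (b + 1)\<close>; the even abscissae strictly in between are those of \<open>a\<close>,
  ..., \<open>b\<close>. The zigzags on both sides vanish at even abscissae.\<close>

lemma join_irr_atLeastAtMost:
  assumes "1 \<le> a" "a \<le> b" "b \<le> n - 1"
  shows "join_irr n {a..b} \<in> dyck_paths n"
    and "0 < height (join_irr n {a..b}) (2 * i) \<longleftrightarrow> i \<in> {a..b}"
proof -
  define p m c where "p = a - 1" and "m = b - a + 2" and "c = n - 1 - b"
  have Min_eq: "Min {a..b} = a" and Max_eq: "Max {a..b} = b"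
    using assms(2) by (auto intro: Min_eqI Max_eqI)
  have J: "join_irr n {a..b} = ud_power p @ replicate m Up @ replicate m Down @ ud_power c"
    using assms by (simp add: join_irr_def Let_def Min_eq Max_eq p_def m_def c_def)
  have n: "p + m + c = n" using assms by (simp add: p_def m_def c_def)
  show "join_irr n {a..b} \<in> dyck_paths n"
    unfolding dyck_paths_def J using n by (auto simp: height_mountain)
  show "0 < height (join_irr n {a..b}) (2 * i) \<longleftrightarrow> i \<in> {a..b}"
  proof -
    \<comment> \<open>Here \<open>x\<close> stands for the offset \<open>2 * i - 2 * p\<close> from
      the left foot of the mountain.\<close>
    have "0 < int (min x m) - int (min (x - m) m) \<longleftrightarrow> 0 < x \<and> x < 2 * m" for x
      by auto
    then have "0 < height (join_irr n {a..b}) (2 * i) \<longleftrightarrow> 0 < 2 * i - 2 * p \<and> 2 * i - 2 * p < 2 * m"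
      unfolding J height_mountain by (simp del: diff_diff_left)
    also have "\<dots> \<longleftrightarrow> i \<in> {a..b}"
    proof -
      have "a = Suc p" "b + 2 = a + m" using assms by (simp_all add: p_def m_def)
      then show ?thesis by auto
    qed
    finally show ?thesis .
  qed
qed

subsection \<open>The pseudocomplement\<close>

lemma partial_order_dyck_lattice: "partial_order (dyck_lattice n)"
proof
  show "x .=\<^bsub>dyck_lattice n\<^esub> y"
    if "x \<sqsubseteq>\<^bsub>dyck_lattice n\<^esub> y" "y \<sqsubseteq>\<^bsub>dyck_lattice n\<^esub> x"
    "x \<in> carrier (dyck_lattice n)" "y \<in> carrier (dyck_lattice n)" for x y
    using that by (auto simp: dyck_lattice_def weakly_below_def intro!: dyck_eqI order_antisym)
qed (auto simp: dyck_lattice_def weakly_below_def intro: order_trans)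

text \<open>Suprema are defined by a choice operator; uniqueness of least elements pins the chosen
  value down. Likewise for infima below.\<close>

lemma (in partial_order) sup_eq:
  assumes "least L x (Upper L A)"
  shows "\<Squnion>A = x"
  unfolding sup_def by (rule some_equality) (use assms least_unique in blast)+

lemma (in partial_order) inf_eq:
  assumes "greatest L x (Lower L A)"
  shows "\<Sqinter>A = x"
  unfolding inf_def by (rule some_equality) (use assms greatest_unique in blast)+

lemma height_meet:
  assumes "P \<in> dyck_paths n" "Q \<in> dyck_paths n"
  shows "P \<sqinter>\<^bsub>dyck_lattice n\<^esub> Q \<in> dyck_paths n"
    and "height (P \<sqinter>\<^bsub>dyck_lattice n\<^esub> Q) k = min (height P k) (height Q k)"
proof -
  obtain M where M: "M \<in> dyck_paths n" "\<And>k. height M k = min (height P k) (height Q k)"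
    using dyck_min[OF assms] by blast
  have "greatest (dyck_lattice n) M (Lower (dyck_lattice n) {P, Q})"
    using M assms unfolding greatest_def Lower_def
    by (auto simp: dyck_lattice_def weakly_below_def)
  then have "P \<sqinter>\<^bsub>dyck_lattice n\<^esub> Q = M"
    unfolding meet_def by (rule partial_order.inf_eq[OF partial_order_dyck_lattice])
  with M show "P \<sqinter>\<^bsub>dyck_lattice n\<^esub> Q \<in> dyck_paths n"
    and "height (P \<sqinter>\<^bsub>dyck_lattice n\<^esub> Q) k = min (height P k) (height Q k)"
    by simp_all
qed

text \<open>Heights of the meet are minima of nonnegative numbers, which vanish iff one of the two
  does.\<close>

lemma meet_eq_ud_power_iff:
  assumes "P \<in> dyck_paths n" "Q \<in> dyck_paths n"
  shows "P \<sqinter>\<^bsub>dyck_lattice n\<^esub> Q = ud_power n \<longleftrightarrow>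
    (\<forall>i \<in> {1..n - 1}. height P (2 * i) = 0 \<or> height Q (2 * i) = 0)"
proof -
  have "min (height P k) (height Q k) = 0 \<longleftrightarrow> height P k = 0 \<or> height Q k = 0" for k
    using dyck_height_nonneg[OF assms(1), of k] dyck_height_nonneg[OF assms(2), of k]
    by linarith
  then show ?thesis
    by (simp add: dyck_eq_ud_power_iff[OF height_meet(1)[OF assms]] height_meet(2)[OF assms])
qed

text \<open>This is the set \<open>T\<close> of the overview. The abscissae 0 and
  \<open>2 * n\<close> are left out because no atom belongs to them.\<close>

definition returns :: "nat \<Rightarrow> path \<Rightarrow> nat set" where
  "returns n P = {i \<in> {1..n - 1}. height P (2 * i) = 0}"

text \<open>If the join-irreducible is below the pseudocomplement, then at \<open>2 * i\<close> with
  \<open>i\<close> in \<open>I\<close> the join is positive, hence so is some path disjoint from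
  \<open>P\<close>, and \<open>P\<close> must be 0 there. Conversely, if \<open>P\<close> is 0 at
  all these abscissae, the join-irreducible is itself disjoint from \<open>P\<close>.\<close>

lemma join_irr_below_pseudocomplement_iff:
  assumes P: "P \<in> dyck_paths n" and I: "I \<in> intervals n"
  shows "weakly_below (join_irr n I) (pseudocomplement n P) \<longleftrightarrow> I \<subseteq> returns n P"
proof -
  define A where "A = {Z \<in> dyck_paths n. P \<sqinter>\<^bsub>dyck_lattice n\<^esub> Z = ud_power n}"
  have A_iff: "Z \<in> A \<longleftrightarrow> Z \<in> dyck_paths n \<and>
      (\<forall>i \<in> {1..n - 1}. height P (2 * i) = 0 \<or> height Z (2 * i) = 0)" for Z
    using P meet_eq_ud_power_iff by (auto simp: A_def)
  have "A \<subseteq> dyck_paths n" by (auto simp: A_def)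
  \<comment> \<open>The maximum construction requires a nonempty set.\<close>
  moreover have "ud_power n \<in> A" by (simp add: A_iff ud_power_dyck height_ud_power)
  ultimately obtain R where R: "R \<in> dyck_paths n" "\<And>Z. Z \<in> A \<Longrightarrow> weakly_below Z R"
      "\<And>k. \<exists>Z \<in> A. height R k = height Z k"
    using dyck_Max by (metis empty_iff)
  \<comment> \<open>Every height of \<open>R\<close> is attained by a member of \<open>A\<close>,
    and that member lies below \<open>Y\<close>.\<close>
  have "weakly_below R Y" if "\<And>Z. Z \<in> A \<Longrightarrow> weakly_below Z Y" for Y
    unfolding weakly_below_def using R(3) that by (metis weakly_below_def)
  moreover have "Upper (dyck_lattice n) A = {Y \<in> dyck_paths n. \<forall>Z \<in> A. weakly_below Z Y}"
    using \<open>A \<subseteq> dyck_paths n\<close> by (auto simp: Upper_def dyck_lattice_def)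
  ultimately have "least (dyck_lattice n) R (Upper (dyck_lattice n) A)"
    using R by (auto simp: least_def dyck_lattice_def)
  then have pc: "pseudocomplement n P = R"
    unfolding pseudocomplement_def A_def
    by (rule partial_order.sup_eq[OF partial_order_dyck_lattice])
  obtain a b where ab: "I = {a..b}" "1 \<le> a" "a \<le> b" "b \<le> n - 1"
    using I by (rule intervals_atLeastAtMost)
  note J = join_irr_atLeastAtMost[OF ab(2-4), folded ab(1)]
  show ?thesis
  proof
    assume below: "weakly_below (join_irr n I) (pseudocomplement n P)"
    show "I \<subseteq> returns n P"
    proof
      fix i assume i: "i \<in> I"
      then have "0 < height R (2 * i)"
        using J(2)[of i] below pc unfolding weakly_below_def by (metis order_less_le_trans)
      moreover obtain Z where "Z \<in> A" "height R (2 * i) = height Z (2 * i)"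
        using R(3) by blast
      moreover have "i \<in> {1..n - 1}" using i ab by auto
      ultimately show "i \<in> returns n P" by (force simp: A_iff returns_def)
    qed
  next
    assume sub: "I \<subseteq> returns n P"
    have "height P (2 * i) = 0 \<or> height (join_irr n I) (2 * i) = 0" for i
      using J(2)[of i] sub dyck_height_nonneg[OF J(1), of "2 * i"]
      by (cases "i \<in> I") (auto simp: returns_def)
    then have "join_irr n I \<in> A" by (simp add: A_iff J(1))
    then show "weakly_below (join_irr n I) (pseudocomplement n P)"
      using R(2) pc by simp
  qed
qed

subsection \<open>Maximal intervals\<close>

definition maximal_intervals :: "nat \<Rightarrow> nat set \<Rightarrow> nat set set" where
  "maximal_intervals n T =
    {I \<in> intervals n. I \<subseteq> T \<and> (\<forall>I' \<in> intervals n. I' \<subseteq> T \<longrightarrow> \<not> I \<subset> I')}"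

lemma rep_intervals_pseudocomplement:
  assumes "P \<in> dyck_paths n"
  shows "rep_intervals n (pseudocomplement n P) = maximal_intervals n (returns n P)"
  using join_irr_below_pseudocomplement_iff[OF assms]
  by (auto simp: rep_intervals_def maximal_intervals_def)

text \<open>A strictly larger interval contains a neighbour of one of the ends, so maximality only
  has to be tested at \<open>a - 1\<close> and \<open>Suc b\<close>. For \<open>a = 1\<close> the
  left test is on 0, which is never in \<open>T\<close>.\<close>

lemma maximal_intervals_iff:
  assumes "T \<subseteq> {1..n - 1}"
  shows "I \<in> maximal_intervals n T \<longleftrightarrow>
    (\<exists>a b. I = {a..b} \<and> 1 \<le> a \<and> a \<le> b \<and> I \<subseteq> T \<and> a - 1 \<notin> T \<and> Suc b \<notin> T)"
    (is "_ \<longleftrightarrow> ?ends")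
proof
  assume max: "I \<in> maximal_intervals n T"
  then have I: "I \<in> intervals n" "I \<subseteq> T"
    and no: "\<And>I'. I' \<in> intervals n \<Longrightarrow> I' \<subseteq> T \<Longrightarrow> \<not> I \<subset> I'"
    by (auto simp: maximal_intervals_def)
  obtain a b where ab: "I = {a..b}" "1 \<le> a" "a \<le> b" "b \<le> n - 1"
    using I(1) by (rule intervals_atLeastAtMost)
  have "a - 1 \<notin> T"
  proof
    assume *: "a - 1 \<in> T"
    have "{a - 1..b} = insert (a - 1) I" using ab by auto
    moreover have "1 \<le> a - 1" using * assms by auto
    moreover have "{a - 1..b} \<in> intervals n"
      using ab \<open>1 \<le> a - 1\<close> by (intro intervalsI) auto
    moreover have "a - 1 \<notin> I" using ab by auto
    ultimately show False using no[of "{a - 1..b}"] * I(2) by auto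
  qed
  moreover have "Suc b \<notin> T"
  proof
    assume *: "Suc b \<in> T"
    have "{a..Suc b} = insert (Suc b) I" using ab by auto
    moreover have "Suc b \<le> n - 1" using * assms by auto
    moreover have "{a..Suc b} \<in> intervals n"
      using ab \<open>Suc b \<le> n - 1\<close> by (intro intervalsI) auto
    moreover have "Suc b \<notin> I" using ab by auto
    ultimately show False using no[of "{a..Suc b}"] * I(2) by auto
  qed
  ultimately show ?ends using ab I(2) by blast
next
  assume ?ends
  then obtain a b where ab: "I = {a..b}" "1 \<le> a" "a \<le> b" "I \<subseteq> T" "a - 1 \<notin> T" "Suc b \<notin> T"
    by blast
  have "b \<in> T" using ab by auto
  then have "I \<in> intervals n" using ab assms by (auto simp: intervals_def)
  moreover have "\<not> I \<subset> I'" if I': "I' \<in> intervals n" "I' \<subseteq> T" for I'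
  proof
    assume "I \<subset> I'"
    obtain c d where cd: "I' = {c..d}" using I'(1) by (rule intervals_atLeastAtMost)
    have "a \<in> I'" "b \<in> I'" using \<open>I \<subset> I'\<close> ab by auto
    moreover have "a - 1 \<notin> I'" "Suc b \<notin> I'" using I'(2) ab by auto
    ultimately have "c = a" "d = b" using cd \<open>1 \<le> a\<close> by auto
    with cd ab \<open>I \<subset> I'\<close> show False by blast
  qed
  ultimately show "I \<in> maximal_intervals n T" using ab by (simp add: maximal_intervals_def)
qed

lemma finite_intervals: "finite (intervals n)"
  by (rule finite_subset[of _ "Pow {1..n - 1}"]) (auto simp: intervals_def)

text \<open>There are finitely many intervals inside \<open>T\<close>, so the singleton of
  \<open>t\<close> extends to a maximal one.\<close>

lemma maximal_interval_containing:
  assumes "T \<subseteq> {1..n - 1}" "t \<in> T"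
  obtains a b where "{a..b} \<in> maximal_intervals n T" "t \<in> {a..b}"
    "1 \<le> a" "{a..b} \<subseteq> T" "a - 1 \<notin> T" "Suc b \<notin> T"
proof -
  have "{t..t} \<in> intervals n" using assms by (intro intervalsI) auto
  then have "{t} \<in> {I \<in> intervals n. I \<subseteq> T}" using assms by simp
  from finite_has_maximal2[OF _ this] obtain I where I: "I \<in> {I \<in> intervals n. I \<subseteq> T}" "{t} \<subseteq> I"
      "\<forall>I' \<in> {I \<in> intervals n. I \<subseteq> T}. I \<subseteq> I' \<longrightarrow> I = I'"
    using finite_intervals by auto
  then have "I \<in> maximal_intervals n T" by (auto simp: maximal_intervals_def)
  moreover obtain a b where "I = {a..b}" "1 \<le> a" "I \<subseteq> T" "a - 1 \<notin> T" "Suc b \<notin> T"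
    using calculation unfolding maximal_intervals_iff[OF assms(1)] by blast
  ultimately show ?thesis using I(2) that[of a b] by simp
qed

lemma Union_maximal_intervals:
  assumes "T \<subseteq> {1..n - 1}"
  shows "\<Union> (maximal_intervals n T) = T"
proof
  show "T \<subseteq> \<Union> (maximal_intervals n T)"
    using maximal_interval_containing[OF assms] by blast
qed (auto simp: maximal_intervals_def)

subsection \<open>Counting hills\<close>

text \<open>By parity a hill starts at an even abscissa. Conversely, from a zero the path can only
  go up, and reaching 0 two steps later forces it down again.\<close>

lemma num_hills_eq:
  assumes "P \<in> dyck_paths n"
  shows "num_hills P = card {j. j < n \<and> height P (2 * j) = 0 \<and> height P (2 * Suc j) = 0}"
    (is "_ = card ?H")
proof -
  have "{k. Suc k < length P \<and> P ! k = Up \<and> P ! Suc k = Down \<and>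
      height P k = 0 \<and> height P (k + 2) = 0} = (*) 2 ` ?H" (is "?K = _")
  proof (intro subset_antisym subsetI)
    fix k assume k: "k \<in> ?K"
    then have "even k"
      using dyck_parity[OF assms, of k] by (auto simp: dyck_length[OF assms])
    with k show "k \<in> (*) 2 ` ?H"
      by (auto simp: dyck_length[OF assms] elim!: evenE)
  next
    fix k assume "k \<in> (*) 2 ` ?H"
    then obtain j where j: "k = 2 * j" "j < n" "height P k = 0" "height P (k + 2) = 0"
      by auto
    then have len: "k < length P" "Suc k < length P" by (auto simp: dyck_length[OF assms])
    then have "height P (Suc k) = rise (P ! k)" "height P (k + 2) = rise (P ! k) + rise (P ! Suc k)"
      using j(3) by (simp_all add: height_Suc)
    then show "k \<in> ?K"
      using len j dyck_height_nonneg[OF assms, of "Suc k"]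
      by (cases "P ! k"; cases "P ! Suc k") auto
  qed
  then show ?thesis by (simp add: num_hills_def card_image inj_on_def)
qed

text \<open>Since \<open>s \<notin> T\<close>, a consecutive pair \<open>j, j + 1\<close> of zeros can be charged to its member nearer
  to \<open>s\<close>, which lies in \<open>T\<close>. The elements of \<open>T\<close> not charged are the ends facing away from \<open>s\<close>
  of the internal maximal intervals.\<close>

lemma card_consecutive_zeros:
  assumes T: "T \<subseteq> {1..n - 1}" and s: "s \<in> {1..n - 1}" "s \<notin> T"
  defines "Z \<equiv> insert 0 (insert n T)"
  shows "card T = card {j. j < n \<and> j \<in> Z \<and> Suc j \<in> Z}
    + card (internal_intervals n (maximal_intervals n T))"
proof -
  define H where "H = {j. j < n \<and> j \<in> Z \<and> Suc j \<in> Z}"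
  define F where "F = internal_intervals n (maximal_intervals n T)"
  \<comment> \<open>\<open>f\<close> charges the pair \<open>j\<close>, \<open>Suc j\<close> to its
    member nearer to \<open>s\<close>; \<open>g\<close> below picks the end of an interval facing
    away from \<open>s\<close>.\<close>
  define f where "f j = (if j < s then Suc j else j)" for j
  have Min_Max: "Min {a..b} = a" "Max {a..b} = b" if "a \<le> b" for a b :: nat
    using that by (auto intro: Min_eqI Max_eqI)
  define g where "g I = (if Min I < s then Min I else Max I)" for I :: "nat set"
  have [simp]: "0 \<notin> T" "n \<notin> T" using T s(1) by force+
  have "s < n" "0 < s" using s(1) by auto
  have s_notin: "j \<noteq> s" if "j \<in> T" for j using that s(2) by blast
  have F_iff: "I \<in> F \<longleftrightarrow> (\<exists>a b. I = {a..b} \<and> 1 < a \<and> a \<le> b \<and> b < n - 1 \<and> I \<subseteq> T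
      \<and> a - 1 \<notin> T \<and> Suc b \<notin> T)" for I
  proof -
    have "1 \<notin> {a..b} \<and> n - 1 \<notin> {a..b} \<longleftrightarrow> 1 < a \<and> b < n - 1"
      if "1 \<le> a" "a \<le> b" "{a..b} \<subseteq> T" for a b
    proof -
      have "b \<in> T" using that by auto
      then have "b \<le> n - 1" using T by auto
      with that show ?thesis by auto
    qed
    then show ?thesis
      unfolding F_def internal_intervals_def mem_Collect_eq maximal_intervals_iff[OF T]
      by (metis less_imp_le)
  qed
  have F_cases: "\<exists>a b. I = {a..b} \<and> 1 < a \<and> a \<le> b \<and> b < n - 1 \<and> I \<subseteq> T \<and> a - 1 \<notin> T
      \<and> Suc b \<notin> T \<and> (b < s \<and> g I = a \<or> s < a \<and> g I = b)" if I: "I \<in> F" for I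
  proof -
    obtain a b where ab: "I = {a..b}" "1 < a" "a \<le> b" "b < n - 1" "I \<subseteq> T"
        "a - 1 \<notin> T" "Suc b \<notin> T"
      using I unfolding F_iff by blast
    moreover have "s \<notin> {a..b}" using ab(1,5) s(2) by blast
    then have "b < s \<or> s < a" by auto
    then have "b < s \<and> g I = a \<or> s < a \<and> g I = b"
      using ab(1,3) by (auto simp: g_def Min_Max)
    ultimately show ?thesis by blast
  qed
  have inj_f: "inj_on f H"
  proof (rule inj_onI)
    fix i j assume "i \<in> H" "j \<in> H" "f i = f j"
    \<comment> \<open>A collision between the two branches of \<open>f\<close> could only happen at
      the value \<open>s\<close>, which is not in \<open>Z\<close>.\<close>
    moreover have "Suc i \<noteq> s" "Suc j \<noteq> s"
      using calculation s_notin \<open>s < n\<close> by (auto simp: H_def Z_def)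
    ultimately show "i = j" by (auto simp: f_def split: if_splits)
  qed
  have inj_g: "inj_on g F"
  proof (rule inj_onI)
    fix I I' assume F: "I \<in> F" "I' \<in> F" and eq: "g I = g I'"
    have mem: "g I \<in> I" if "I \<in> F" for I using F_cases[OF that] by auto
    obtain a b where I: "I = {a..b}" "a \<le> b" "I \<subseteq> T" "a - 1 \<notin> T" "Suc b \<notin> T" "1 < a"
      using F(1) F_iff by metis
    obtain c d where I': "I' = {c..d}" "c \<le> d" "I' \<subseteq> T" "c - 1 \<notin> T" "Suc d \<notin> T" "1 < c"
      using F(2) F_iff by metis
    have meet: "g I \<in> {a..b}" "g I \<in> {c..d}" using mem F eq I I' by metis+
    \<comment> \<open>Two maximal intervals with a common point coincide, since neither can contain
      an outer neighbour of the other.\<close>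
    have "Suc b \<notin> {c..d}" "Suc d \<notin> {a..b}" "a - 1 \<notin> {c..d}" "c - 1 \<notin> {a..b}"
      using I I' by blast+
    then have "a = c" "b = d" using meet I(6) I'(6) by auto
    then show "I = I'" using I I' by simp
  qed
  have f_in: "f j \<in> T" if "j \<in> H" for j
    using that \<open>s < n\<close> \<open>0 < s\<close> by (auto simp: f_def H_def Z_def)
  have g_in: "g I \<in> T" if "I \<in> F" for I
    using F_cases[OF that] by auto
  have disj: "f j \<noteq> g I" if j: "j \<in> H" and I: "I \<in> F" for j I
  proof
    assume eq: "f j = g I"
    obtain a b where ab: "1 < a" "a \<le> b" "b < n - 1" "a - 1 \<notin> T" "Suc b \<notin> T" "I = {a..b}"
        "b < s \<and> g I = a \<or> s < a \<and> g I = b"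
      using F_cases[OF I] by metis
    \<comment> \<open>Equality would put \<open>a - 1\<close> or \<open>Suc b\<close> into
      \<open>Z\<close>. These are outside \<open>T\<close>, and since the interval is internal they
      are neither 0 nor \<open>n\<close>.\<close>
    then show False
      using eq j s_notin[of "f j"] f_in[OF j] by (auto simp: f_def H_def Z_def split: if_splits)
  qed
  have cover: "t \<in> f ` H \<union> g ` F" if t: "t \<in> T" for t
  proof -
    obtain a b where ab: "{a..b} \<in> maximal_intervals n T" "t \<in> {a..b}"
        "1 \<le> a" "{a..b} \<subseteq> T" "a - 1 \<notin> T" "Suc b \<notin> T"
      using maximal_interval_containing[OF T t] by metis
    have "a \<in> T" "b \<in> T" using ab(2,4) by auto
    then have "b \<le> n - 1" using T by auto
    have "s \<notin> {a..b}" using ab(4) s(2) by blast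
    then consider "b < s" | "s < a" using ab(2) by fastforce
    then show ?thesis
    proof cases
      case 1
      show ?thesis
      proof (cases "t - 1 \<in> Z")
        case True
        then have "t - 1 \<in> H" "f (t - 1) = t"
          using t ab 1 \<open>s < n\<close> by (auto simp: H_def Z_def f_def)
        then show ?thesis by force
      next
        case False
        have "t = a"
        proof (rule ccontr)
          assume "t \<noteq> a"
          then have "t - 1 \<in> {a..b}" using ab by auto
          then show False using False ab(4) by (auto simp: Z_def)
        qed
        \<comment> \<open>If \<open>a\<close> were 1, then \<open>t - 1\<close> would be 0, which is
          in \<open>Z\<close>; hence the interval is internal on the left. On the right it is
          because \<open>b < s\<close>.\<close>
        then have "1 < a" using False t ab(3) by (cases "a = 1") (auto simp: Z_def)
        then have "{a..b} \<in> F" using ab 1 \<open>s < n\<close> unfolding F_iff by auto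
        moreover have "g {a..b} = t" using \<open>t = a\<close> 1 ab by (auto simp: g_def Min_Max)
        ultimately show ?thesis by blast
      qed
    next
      case 2
      show ?thesis
      proof (cases "Suc t \<in> Z")
        case True
        then have "t \<in> H" "f t = t"
          using t ab 2 \<open>b \<le> n - 1\<close> \<open>s < n\<close> by (auto simp: H_def Z_def f_def)
        then show ?thesis by force
      next
        case False
        have "t = b"
        proof (rule ccontr)
          assume "t \<noteq> b"
          then have "Suc t \<in> {a..b}" using ab by auto
          then show False using False ab(4) by (auto simp: Z_def)
        qed
        \<comment> \<open>Symmetrically, \<open>b = n - 1\<close> would make \<open>Suc t\<close>
          equal to \<open>n\<close>, which is in \<open>Z\<close>.\<close>
        then have "b < n - 1" using False \<open>b \<le> n - 1\<close> \<open>s < n\<close> by (auto simp: Z_def)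
        moreover have "1 < a" using 2 \<open>0 < s\<close> by simp
        ultimately have "{a..b} \<in> F" using ab unfolding F_iff by auto
        moreover have "g {a..b} = t" using \<open>t = b\<close> 2 ab by (auto simp: g_def Min_Max)
        ultimately show ?thesis by blast
      qed
    qed
  qed
  have "T = f ` H \<union> g ` F" using cover f_in g_in by blast
  moreover have "finite T" using T finite_subset by blast
  moreover have "f ` H \<inter> g ` F = {}" using disj by blast
  ultimately have "card T = card (f ` H) + card (g ` F)"
    by (metis card_Un_disjoint finite_Un)
  then show ?thesis
    using inj_f inj_g by (simp add: card_image H_def F_def)
qed

text \<open>The minimum is excluded: for \<open>n >= 1\<close> it has \<open>n\<close> hills,
  whereas its pseudocomplement is the maximum and the right-hand side is
  \<open>n - 1\<close>.\<close>

theorem corollary5p1: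
  fixes n :: nat and P :: path
  assumes "P \<in> dyck_paths n" and "P \<noteq> ud_power n"
  shows "int (num_hills P) =
           int (card (\<Union> (rep_intervals n (pseudocomplement n P))))
           - int (card (internal_intervals n (rep_intervals n (pseudocomplement n P))))"
proof -
  let ?T = "returns n P"
  have T: "?T \<subseteq> {1..n - 1}" by (auto simp: returns_def)
  \<comment> \<open>A path other than the minimum is positive at some even abscissa; its half serves
    as the separating point \<open>s\<close>.\<close>
  obtain s where s: "s \<in> {1..n - 1}" "s \<notin> ?T"
    using assms dyck_eq_ud_power_iff by (auto simp: returns_def)
  have "height P (2 * i) = 0 \<longleftrightarrow> i \<in> insert 0 (insert n ?T)" if "i \<le> n" for i
    using that dyck_height_end[OF assms(1), of "2 * i"]
    by (cases "i = 0 \<or> i = n") (auto simp: returns_def)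
  then have "{j. j < n \<and> height P (2 * j) = 0 \<and> height P (2 * Suc j) = 0} =
      {j. j < n \<and> j \<in> insert 0 (insert n ?T) \<and> Suc j \<in> insert 0 (insert n ?T)}"
    by (metis (no_types, lifting) Suc_leI less_imp_le)
  then show ?thesis
    using card_consecutive_zeros[OF T s]
    by (simp only: num_hills_eq[OF assms(1)] rep_intervals_pseudocomplement[OF assms(1)]
        Union_maximal_intervals[OF T])
qed

end
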